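(* Let $P$ be the poset defined in the context, and let $L=P\cup\{\top,\bot\}$ be obtained by adjoining two new elements $\top$ and $\bot$ to $P$ such that $\bot<x<\top$ for every $x\in P$ (keeping the order of $P$ on $P$). Then $L$ is a complete lattice, and $L$ with its Scott topology is not a sober space.
   Context: Countable means of cardinality at most $\aleph_0$ (finite sets included). For a set $M$, $[M]^\omega$ is the set of countably infinite subsets of $M$, $[M]^{\le\omega}$ the set of all countable subsets of $M$ (including finite sets and $\varnothing$), and $[M]^{<\omega}$ the set of finite subsets of $M$. The detector family. Fix a family $\mathcal A\subseteq[\mathbb R]^\omega$ of cardinality $\mathfrak c=|\mathbb R|$ that is almost disjoint ($A\cap B$ is finite for distinct $A,B\in\mathcal A$) and such that every uncountable $B\subseteq\mathbb R$ contains some $A\in\mathcal A$ as a subset (such a family exists in ZFC by a theorem of Komjáth). Let $2^{<\omega}$ be the set of finite binary sequences and $2^\omega$ the set of functions $\omega\to\{0,1\}$; for $\xi\in2^\omega$ let $\xi\upharpoonright n$ be its restriction to the first $n$ coordinates. For each $A\in\mathcal A$ fix an injection $e_A:2^{<\omega}\to A$, and for $\xi\in2^\omega$ put $A^\xi=\{e_A(\xi\upharpoonright n):n<\omega\}$. Fix a bijection $\beta:\mathbb R\to2^\omega$ and, for $p\in\mathbb R$, put $\mathcal S_p=\{A^{\beta(p)}\setminus\{p\}:A\in\mathcal A\}$. The topology $\tau$. For $p\in\mathbb R$, $S\in\mathcal S_p$ and finite $F\subseteq S$, let $K(p,S,F)=\{p\}\cup(S\setminus F)$. Let $\mathscr K=\{\mathbb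 R\}\cup\{\{x\}:x\in\mathbb R\}\cup\{K(p,S,F):p\in\mathbb R,\ S\in\mathcal S_p,\ F\in[S]^{<\omega}\}$, and let $\tau$ be the topology on $\mathbb R$ having $\{\mathbb R\setminus K:K\in\mathscr K\}$ as a subbase of open sets. The poset $P$. Let $\mathcal C$ be the set of nonempty $\tau$-closed subsets of $\mathbb R$. For $C\in\mathcal C$ let $E_C=[\mathbb R\setminus C]^{\le\omega}$. Let $P=\{(C,\Lambda):C\in\mathcal C,\ \Lambda\subseteq E_C\}$, ordered by $(C,\Lambda)\le(D,\Gamma)$ iff $D\subseteq C$ and $\Lambda\subseteq\Gamma$. Scott topology. A nonempty subset $D$ of a poset is directed if any two elements of $D$ have an upper bound in $D$. The Scott topology on a poset consists of the upper sets $U$ such that whenever $D$ is directed, has a supremum, and $\bigvee D\in U$, then $D\cap U\ne\varnothing$. A space is sober if every irreducible closed subset is the closure of a unique point. *)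

theory Defs
  imports "HOL-Analysis.Analysis" "HOL-Algebra.Complete_Lattice"
begin

section \<open>Scott topology and sobriety\<close>

definition directed_in :: "('a, 'b) gorder_scheme \<Rightarrow> 'a set \<Rightarrow> bool" where
  "directed_in L D \<longleftrightarrow> D \<subseteq> carrier L \<and> D \<noteq> {} \<and>
     (\<forall>x\<in>D. \<forall>y\<in>D. \<exists>z\<in>D. x \<sqsubseteq>\<^bsub>L\<^esub> z \<and> y \<sqsubseteq>\<^bsub>L\<^esub> z)"

definition scott_open :: "('a, 'b) gorder_scheme \<Rightarrow> 'a set \<Rightarrow> bool" where
  "scott_open L U \<longleftrightarrow> U \<subseteq> carrier L \<and>
     (\<forall>x\<in>U. \<forall>y\<in>carrier L. x \<sqsubseteq>\<^bsub>L\<^esub> y \<longrightarrow> y \<in> U) \<and>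
     (\<forall>D s. directed_in L D \<and> is_lub L s D \<and> s \<in> U \<longrightarrow> D \<inter> U \<noteq> {})"

definition scott_topology :: "('a, 'b) gorder_scheme \<Rightarrow> 'a topology" where
  "scott_topology L = topology (scott_open L)"

lemma istopology_scott_open: "istopology (scott_open L)"
proof -
  have "scott_open L (S \<inter> T)" if S: "scott_open L S" and T: "scott_open L T" for S T
    unfolding scott_open_def
  proof (intro conjI allI impI)
    show "S \<inter> T \<subseteq> carrier L"
      using S by (auto simp: scott_open_def)
    show "\<forall>x\<in>S \<inter> T. \<forall>y\<in>carrier L. x \<sqsubseteq>\<^bsub>L\<^esub> y \<longrightarrow> y \<in> S \<inter> T"
      using S T unfolding scott_open_def by blast
    fix D s assume D: "directed_in L D \<and> is_lub L s D \<and> s \<in> S \<inter> T"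
    obtain a where a: "a \<in> D" "a \<in> S"
      using S D unfolding scott_open_def by blast
    obtain b where b: "b \<in> D" "b \<in> T"
      using T D unfolding scott_open_def by blast
    obtain c where c: "c \<in> D" "c \<in> carrier L" "a \<sqsubseteq>\<^bsub>L\<^esub> c" "b \<sqsubseteq>\<^bsub>L\<^esub> c"
      using D a b unfolding directed_in_def by blast
    have "c \<in> S" "c \<in> T"
      using S T a b c unfolding scott_open_def by blast+
    then show "D \<inter> (S \<inter> T) \<noteq> {}"
      using c by blast
  qed
  moreover have "scott_open L (\<Union>\<K>)" if "\<forall>K\<in>\<K>. scott_open L K" for \<K>
    unfolding scott_open_def
  proof (intro conjI allI impI)
    show "\<Union>\<K> \<subseteq> carrier L"
      using that by (auto simp: scott_open_def)
    show "\<forall>x\<in>\<Union>\<K>. \<forall>y\<in>carrier L. x \<sqsubseteq>\<^bsub>L\<^esub> y \<longrightarrow> y \<in> \<Union>\<K>"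
      using that unfolding scott_open_def by blast
    fix D s assume D: "directed_in L D \<and> is_lub L s D \<and> s \<in> \<Union>\<K>"
    then obtain K where K: "K \<in> \<K>" "s \<in> K" by blast
    then have "D \<inter> K \<noteq> {}"
      using that D unfolding scott_open_def by blast
    then show "D \<inter> \<Union>\<K> \<noteq> {}"
      using K by blast
  qed
  ultimately show ?thesis
    unfolding istopology_def by blast
qed

lemma openin_scott_topology: "openin (scott_topology L) U \<longleftrightarrow> scott_open L U"
  by (simp add: scott_topology_def istopology_scott_open)

lemma (in partial_order) topspace_scott_topology: "topspace (scott_topology L) = carrier L"
proof -
  have "scott_open L (carrier L)"
    by (auto simp: scott_open_def directed_in_def)
  moreover have "U \<subseteq> carrier L" if "scott_open L U" for U
    using that by (simp add: scott_open_def)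
  ultimately show ?thesis
    unfolding topspace_def openin_scott_topology by blast
qed

definition irreducible_closedin :: "'a topology \<Rightarrow> 'a set \<Rightarrow> bool" where
  "irreducible_closedin X C \<longleftrightarrow> closedin X C \<and> C \<noteq> {} \<and>
     (\<forall>A B. closedin X A \<and> closedin X B \<and> C = A \<union> B \<longrightarrow> C = A \<or> C = B)"

definition sober_space :: "'a topology \<Rightarrow> bool" where
  "sober_space X \<longleftrightarrow>
     (\<forall>C. irreducible_closedin X C \<longrightarrow> (\<exists>!x. x \<in> topspace X \<and> C = X closure_of {x}))"

section \<open>Adjoining a top and a bottom element\<close>

datatype 'a bounded_ext = Bottom | Elem 'a | Top

fun bounded_ext_le :: "('a \<Rightarrow> 'a \<Rightarrow> bool) \<Rightarrow> 'a bounded_ext \<Rightarrow> 'a bounded_ext \<Rightarrow> bool" where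
  "bounded_ext_le r Bottom y = True"
| "bounded_ext_le r (Elem a) Bottom = False"
| "bounded_ext_le r (Elem a) (Elem b) = r a b"
| "bounded_ext_le r (Elem a) Top = True"
| "bounded_ext_le r Top y = (y = Top)"

definition adjoin_bounds :: "'a gorder \<Rightarrow> 'a bounded_ext gorder" where
  "adjoin_bounds Q =
     \<lparr>carrier = {Bottom, Top} \<union> Elem ` carrier Q, eq = (=), le = bounded_ext_le (le Q)\<rparr>"

section \<open>Detector families\<close>

definition detector_family :: "real set set \<Rightarrow> bool" where
  "detector_family \<A> \<longleftrightarrow>
     (\<forall>A\<in>\<A>. countable A \<and> infinite A) \<and>
     \<A> \<approx> (UNIV :: real set) \<and>
     (\<forall>A\<in>\<A>. \<forall>B\<in>\<A>. A \<noteq> B \<longrightarrow> finite (A \<inter> B)) \<and>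
     (\<forall>B. uncountable B \<longrightarrow> (\<exists>A\<in>\<A>. A \<subseteq> B))"

text \<open>
  Finite binary sequences are lists of type \<^typ>\<open>bool list\<close>, infinite ones are functions
  of type \<^typ>\<open>nat \<Rightarrow> bool\<close>.
\<close>

definition restrict_seq :: "(nat \<Rightarrow> bool) \<Rightarrow> nat \<Rightarrow> bool list" where
  "restrict_seq \<xi> n = map \<xi> [0..<n]"

text \<open>The set $A^\xi$, where \<open>e\<close> is indexed by the members of the detector family.\<close>

definition branch_set ::
    "(real set \<Rightarrow> bool list \<Rightarrow> real) \<Rightarrow> real set \<Rightarrow> (nat \<Rightarrow> bool) \<Rightarrow> real set" where
  "branch_set e A \<xi> = {e A (restrict_seq \<xi> n) | n. True}"

definition S_at ::
    "real set set \<Rightarrow> (real set \<Rightarrow> bool list \<Rightarrow> real) \<Rightarrow> (real \<Rightarrow> nat \<Rightarrow> bool) \<Rightarrow> real \<Rightarrow> real set set" where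
  "S_at \<A> e \<beta> p = {branch_set e A (\<beta> p) - {p} | A. A \<in> \<A>}"

section \<open>The topology on the reals\<close>

definition K_set :: "real \<Rightarrow> real set \<Rightarrow> real set \<Rightarrow> real set" where
  "K_set p S F = {p} \<union> (S - F)"

definition K_family ::
    "real set set \<Rightarrow> (real set \<Rightarrow> bool list \<Rightarrow> real) \<Rightarrow> (real \<Rightarrow> nat \<Rightarrow> bool) \<Rightarrow> real set set" where
  "K_family \<A> e \<beta> =
     {UNIV} \<union> {{x} | x. True} \<union>
     {K_set p S F | p S F. S \<in> S_at \<A> e \<beta> p \<and> finite F \<and> F \<subseteq> S}"

definition tau ::
    "real set set \<Rightarrow> (real set \<Rightarrow> bool list \<Rightarrow> real) \<Rightarrow> (real \<Rightarrow> nat \<Rightarrow> bool) \<Rightarrow> real topology" where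
  "tau \<A> e \<beta> = topology_generated_by {UNIV - K | K. K \<in> K_family \<A> e \<beta>}"

text \<open>The singletons in \<^const>\<open>K_family\<close> ensure that the subbase covers the real line.\<close>

lemma topspace_tau: "topspace (tau \<A> e \<beta>) = UNIV"
proof -
  have "\<exists>K. K \<in> K_family \<A> e \<beta> \<and> x \<in> UNIV - K" for x
    by (rule exI[of _ "{x + 1}"]) (auto simp: K_family_def)
  then show ?thesis
    unfolding tau_def topology_generated_by_topspace by blast
qed

section \<open>The poset\<close>

definition countable_subsets :: "'a set \<Rightarrow> 'a set set" where
  "countable_subsets M = {X. X \<subseteq> M \<and> countable X}"

definition P_poset ::
    "real set set \<Rightarrow> (real set \<Rightarrow> bool list \<Rightarrow> real) \<Rightarrow> (real \<Rightarrow> nat \<Rightarrow> bool)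
      \<Rightarrow> (real set \<times> real set set) gorder" where
  "P_poset \<A> e \<beta> =
     \<lparr>carrier = {(C, \<Lambda>). closedin (tau \<A> e \<beta>) C \<and> C \<noteq> {} \<and> \<Lambda> \<subseteq> countable_subsets (UNIV - C)},
      eq = (=),
      le = (\<lambda>(C, \<Lambda>) (D, \<Gamma>). D \<subseteq> C \<and> \<Lambda> \<subseteq> \<Gamma>)\<rparr>"

end

theory Submission
  imports Defs
begin

text \<open>
  The topology \<^const>\<open>tau\<close> is compact by Alexander's lemma: two subbasic closed sets with
  different apices \<open>p \<noteq> q\<close> meet in a finite set, by almost disjointness of the detector family
  and of distinct branches.  Hence directed subsets of \<open>P\<close> are bounded and \<^const>\<open>Top\<close> is
  isolated in the Scott topology.  The set of the remaining elements is then closed; it has no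
  generic point, since \<open>P\<close> has no greatest element, and it is irreducible as soon as any two Scott
  open sets that meet \<open>P\<close> also meet each other inside \<open>P\<close>.  To see this, let \<open>U\<close> be Scott open
  and let \<open>W\<close> be the set of reals \<open>p\<close> such that the maximal element
  \<open>({p}, countable_subsets (UNIV - {p}))\<close> is not in \<open>U\<close>.  If \<open>p \<notin> W\<close>, then already
  \<open>({p}, \<Lambda>) \<in> U\<close> for some finite \<open>\<Lambda>\<close>, and every \<open>S\<close> attached to \<open>p\<close> that is almost disjoint
  from the countable set \<open>\<Union>\<Lambda>\<close> meets \<open>W\<close> in a finite set.  If \<open>W\<close> were uncountable, the
  detector family would provide such an infinite \<open>S\<close> inside \<open>W - \<Union>\<Lambda>\<close>.  So \<open>W\<close> is countable,
  and two cocountable sets of reals intersect.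
\<close>

section \<open>Orders with adjoined bounds\<close>

lemma carrier_adjoin_bounds [simp]:
  "carrier (adjoin_bounds Q) = {Bottom, Top} \<union> Elem ` carrier Q"
  by (simp add: adjoin_bounds_def)

lemma eq_adjoin_bounds [simp]: "eq (adjoin_bounds Q) = (=)"
  by (simp add: adjoin_bounds_def)

lemma le_adjoin_bounds [simp]: "le (adjoin_bounds Q) = bounded_ext_le (le Q)"
  by (simp add: adjoin_bounds_def)

lemma bounded_ext_le_Top [simp]: "bounded_ext_le r x Top"
  by (cases x) auto

lemma bounded_ext_le_Bottom [simp]: "bounded_ext_le r x Bottom \<longleftrightarrow> x = Bottom"
  by (cases x) auto

lemma partial_order_adjoin_bounds:
  assumes "partial_order Q"
  shows "partial_order (adjoin_bounds Q)"
proof -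
  interpret partial_order Q by fact
  show ?thesis
  proof
    fix x y z
    assume "x \<sqsubseteq>\<^bsub>adjoin_bounds Q\<^esub> y" "y \<sqsubseteq>\<^bsub>adjoin_bounds Q\<^esub> z" "x \<in> carrier (adjoin_bounds Q)"
      "y \<in> carrier (adjoin_bounds Q)" "z \<in> carrier (adjoin_bounds Q)"
    then show "x \<sqsubseteq>\<^bsub>adjoin_bounds Q\<^esub> z"
      by (cases x; cases y; cases z) (auto intro: le_trans)
  next
    fix x y
    assume "x \<sqsubseteq>\<^bsub>adjoin_bounds Q\<^esub> y" "y \<sqsubseteq>\<^bsub>adjoin_bounds Q\<^esub> x" "x \<in> carrier (adjoin_bounds Q)"
      "y \<in> carrier (adjoin_bounds Q)"
    then show "x .=\<^bsub>adjoin_bounds Q\<^esub> y"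
      by (cases x; cases y) auto
  qed auto
qed

text \<open>\<open>Upper\<close> tests only members that lie in the carrier, so it takes a nonempty
  \<open>D\<close> inside the carrier to exclude \<open>Bottom\<close> as an upper bound.\<close>

lemma Upper_adjoin_bounds:
  assumes "D \<subseteq> carrier Q" "D \<noteq> {}"
  shows "Upper (adjoin_bounds Q) (Elem ` D) = insert Top (Elem ` Upper Q D)"
proof (rule Set.set_eqI)
  fix u show "u \<in> Upper (adjoin_bounds Q) (Elem ` D) \<longleftrightarrow> u \<in> insert Top (Elem ` Upper Q D)"
    using assms by (cases u) (force simp: Upper_def)+
qed

lemma is_lub_adjoin_bounds:
  assumes D: "D \<subseteq> carrier Q" "D \<noteq> {}" and s: "is_lub Q s D"
  shows "is_lub (adjoin_bounds Q) (Elem s) (Elem ` D)"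
proof -
  show ?thesis
    using s unfolding least_def Upper_adjoin_bounds[OF D] by (auto simp: Upper_def)
qed

text \<open>This lets all later arguments about Scott open sets take place inside \<open>Q\<close>,
  without reference to the added bounds.\<close>

lemma scott_open_adjoin_bounds_directed:
  assumes U: "scott_open (adjoin_bounds Q) U" and D: "directed_in Q D"
    and s: "is_lub Q s D" "Elem s \<in> U"
  shows "\<exists>d\<in>D. Elem d \<in> U"
proof -
  have "directed_in (adjoin_bounds Q) (Elem ` D)"
    using D unfolding directed_in_def by auto
  moreover have "is_lub (adjoin_bounds Q) (Elem s) (Elem ` D)"
    using D s by (intro is_lub_adjoin_bounds) (auto simp: directed_in_def)
  ultimately have "Elem ` D \<inter> U \<noteq> {}"
    using U s unfolding scott_open_def by blast
  then show ?thesis by blast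
qed

lemma scott_open_adjoin_bounds_mono:
  assumes "scott_open (adjoin_bounds Q) U" "Elem a \<in> U" "b \<in> carrier Q" "a \<sqsubseteq>\<^bsub>Q\<^esub> b"
  shows "Elem b \<in> U"
  using assms unfolding scott_open_def by auto

section \<open>Completeness of an order with adjoined bounds\<close>

lemma (in partial_order) complete_lattice_if_sups:
  assumes sup: "\<And>A. A \<subseteq> carrier L \<Longrightarrow> \<exists>s. is_lub L s A"
  shows "complete_lattice L"
proof (rule complete_latticeI)
  fix A assume A: "A \<subseteq> carrier L"
  \<comment> \<open>The infimum is obtained as the supremum of all lower bounds.\<close>
  obtain i where i: "is_lub L i (Lower L A)"
    using sup[of "Lower L A"] by (auto simp: Lower_def)
  have "i \<sqsubseteq> a" if "a \<in> A" for a
    using that A i by (auto simp: least_def Upper_def Lower_def)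
  with i have "greatest L i (Lower L A)"
    by (auto simp: greatest_def least_def Upper_def Lower_def)
  then show "\<exists>i. greatest L i (Lower L A)" ..
qed (fact sup)

text \<open>The two new elements supply exactly the suprema that may be missing in \<open>Q\<close>:
  \<open>Bottom\<close> serves the empty set and \<open>Top\<close> the sets that are unbounded in
  \<open>Q\<close>.\<close>

lemma complete_lattice_adjoin_bounds:
  assumes "partial_order Q"
    and lub: "\<And>A. A \<subseteq> carrier Q \<Longrightarrow> A \<noteq> {} \<Longrightarrow> Upper Q A \<noteq> {} \<Longrightarrow> \<exists>s. is_lub Q s A"
  shows "complete_lattice (adjoin_bounds Q)"
proof -
  interpret L: partial_order "adjoin_bounds Q"
    using assms(1) by (rule partial_order_adjoin_bounds)
  show ?thesis
  proof (rule L.complete_lattice_if_sups)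
    fix A assume A: "A \<subseteq> carrier (adjoin_bounds Q)"
    define A' where "A' = {a. Elem a \<in> A}"
    have A': "A' \<subseteq> carrier Q"
      using A by (auto simp: A'_def)
    have A_eq: "A - {Bottom, Top} = Elem ` A'"
      using A by (auto simp: A'_def)
    \<comment> \<open>\<open>Bottom\<close> imposes no condition on upper bounds, so only the trace
      \<open>A'\<close> of \<open>A\<close> on \<open>Q\<close> matters.\<close>
    have Upper_A: "Upper (adjoin_bounds Q) A = Upper (adjoin_bounds Q) (Elem ` A')" if "Top \<notin> A"
    proof -
      have "Elem ` A' \<subseteq> A" "A \<subseteq> insert Bottom (Elem ` A')"
        using A_eq that by blast+
      show ?thesis
      proof
        show "Upper (adjoin_bounds Q) A \<subseteq> Upper (adjoin_bounds Q) (Elem ` A')"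
          using \<open>Elem ` A' \<subseteq> A\<close> by (rule Upper_antimono)
        show "Upper (adjoin_bounds Q) (Elem ` A') \<subseteq> Upper (adjoin_bounds Q) A"
        proof
          fix u assume u: "u \<in> Upper (adjoin_bounds Q) (Elem ` A')"
          have "x \<sqsubseteq>\<^bsub>adjoin_bounds Q\<^esub> u" if "x \<in> A" for x
          proof (cases "x = Bottom")
            case False
            then have "x \<in> Elem ` A'"
              using that \<open>A \<subseteq> insert Bottom (Elem ` A')\<close> by blast
            then show ?thesis
              using u A \<open>Elem ` A' \<subseteq> A\<close> unfolding Upper_def by blast
          qed simp
          then show "u \<in> Upper (adjoin_bounds Q) A"
            using u by (simp add: Upper_def)
        qed
      qed
    qed
    consider "Top \<in> A" | "Top \<notin> A" "A' = {}" | "Top \<notin> A" "A' \<noteq> {}" "Upper Q A' = {}"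
      | "Top \<notin> A" "A' \<noteq> {}" "Upper Q A' \<noteq> {}" by blast
    then show "\<exists>s. is_lub (adjoin_bounds Q) s A"
    proof cases
      case 1
      then have "is_lub (adjoin_bounds Q) Top A"
        by (auto simp: least_def Upper_def)
      then show ?thesis ..
    next
      case 2
      then have "A \<subseteq> {Bottom}"
        using A_eq by blast
      then have "is_lub (adjoin_bounds Q) Bottom A"
        by (auto simp: least_def Upper_def)
      then show ?thesis ..
    next
      case 3
      then have "Upper (adjoin_bounds Q) A = {Top}"
        using Upper_A Upper_adjoin_bounds[OF A'] by simp
      then have "is_lub (adjoin_bounds Q) Top A"
        by (simp add: least_def)
      then show ?thesis ..
    next
      case 4
      then obtain s where s: "is_lub Q s A'"
        using lub A' by blast
      have "is_lub (adjoin_bounds Q) (Elem s) A"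
        using is_lub_adjoin_bounds[OF A' 4(2) s] Upper_A[OF 4(1)] by simp
      then show ?thesis ..
    qed
  qed
qed

section \<open>Scott topology and sobriety with adjoined bounds\<close>

lemma scott_open_Top:
  assumes ub: "\<And>D. directed_in Q D \<Longrightarrow> Upper Q D \<noteq> {}"
  shows "scott_open (adjoin_bounds Q) {Top}"
  unfolding scott_open_def
proof (intro conjI allI impI)
  fix D s
  assume *: "directed_in (adjoin_bounds Q) D \<and> is_lub (adjoin_bounds Q) s D \<and> s \<in> {Top}"
  then have D: "D \<subseteq> carrier (adjoin_bounds Q)" and lub: "is_lub (adjoin_bounds Q) Top D"
    and dir: "\<And>x y. x \<in> D \<Longrightarrow> y \<in> D \<Longrightarrow> \<exists>z\<in>D. x \<sqsubseteq>\<^bsub>adjoin_bounds Q\<^esub> z \<and> y \<sqsubseteq>\<^bsub>adjoin_bounds Q\<^esub> z"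
    by (auto simp: directed_in_def)
  show "D \<inter> {Top} \<noteq> {}"
  proof (rule ccontr)
    assume "\<not> D \<inter> {Top} \<noteq> {}"
    then have Top: "Top \<notin> D" by blast
    define D' where "D' = {a. Elem a \<in> D}"
    have D': "D' \<subseteq> carrier Q"
      using D by (auto simp: D'_def)
    have D_sub: "D \<subseteq> insert Bottom (Elem ` D')"
      using D Top by (auto simp: D'_def)
    \<comment> \<open>The trace of \<open>D\<close> on \<open>Q\<close> is empty or directed. In the
      first case \<open>Bottom\<close> bounds \<open>D\<close>, in the second an element of
      \<open>Q\<close> does; either way \<open>Top\<close> is not the least upper bound.\<close>
    have "\<exists>u \<in> Upper (adjoin_bounds Q) D. u \<noteq> Top"
    proof (cases "D' = {}")
      case True
      with D_sub have "Bottom \<in> Upper (adjoin_bounds Q) D"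
        by (auto simp: Upper_def)
      then show ?thesis by blast
    next
      case False
      have "\<exists>c\<in>D'. a \<sqsubseteq>\<^bsub>Q\<^esub> c \<and> b \<sqsubseteq>\<^bsub>Q\<^esub> c" if ab: "a \<in> D'" "b \<in> D'" for a b
      proof -
        obtain z where z: "z \<in> D" "Elem a \<sqsubseteq>\<^bsub>adjoin_bounds Q\<^esub> z" "Elem b \<sqsubseteq>\<^bsub>adjoin_bounds Q\<^esub> z"
          using dir[of "Elem a" "Elem b"] ab unfolding D'_def by blast
        then show ?thesis
          using Top by (cases z) (auto simp: D'_def)
      qed
      with False D' have "directed_in Q D'"
        by (simp add: directed_in_def)
      then obtain u where u: "u \<in> Upper Q D'"
        using ub by blast
      then have "Elem u \<in> Upper (adjoin_bounds Q) D"
        using D_sub D' by (auto simp: Upper_def)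
      then show ?thesis by blast
    qed
    with lub show False
      by (auto simp: least_def)
  qed
qed auto

text \<open>Principal down-sets are Scott closed: if \<open>x\<close> bounds \<open>D\<close>, it
  bounds every supremum of \<open>D\<close>. Hence a generic point of a closed set is its greatest
  element.\<close>

lemma (in partial_order) closure_of_subset_down_set:
  assumes x: "x \<in> carrier L"
  shows "scott_topology L closure_of {x} \<subseteq> {y \<in> carrier L. y \<sqsubseteq> x}"
proof (rule closure_of_minimal)
  have "scott_open L (carrier L - {y \<in> carrier L. y \<sqsubseteq> x})"
    unfolding scott_open_def
  proof (intro conjI ballI allI impI)
    fix y z assume "y \<in> carrier L - {y \<in> carrier L. y \<sqsubseteq> x}" "z \<in> carrier L" "y \<sqsubseteq> z"
    then show "z \<in> carrier L - {y \<in> carrier L. y \<sqsubseteq> x}"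
      using x le_trans by blast
  next
    fix D s assume *: "directed_in L D \<and> is_lub L s D \<and> s \<in> carrier L - {y \<in> carrier L. y \<sqsubseteq> x}"
    then have "x \<notin> Upper L D"
      by (auto simp: least_def)
    with * x show "D \<inter> (carrier L - {y \<in> carrier L. y \<sqsubseteq> x}) \<noteq> {}"
      by (auto simp: Upper_def directed_in_def)
  qed auto
  then show "closedin (scott_topology L) {y \<in> carrier L. y \<sqsubseteq> x}"
    by (auto simp: closedin_def topspace_scott_topology openin_scott_topology)
qed (use x in auto)

text \<open>The witness is the set of all elements other than \<^const>\<open>Top\<close>.\<close>

lemma not_sober_adjoin_bounds:
  assumes "partial_order Q"
    and ub: "\<And>D. directed_in Q D \<Longrightarrow> Upper Q D \<noteq> {}"
    and nonempty: "carrier Q \<noteq> {}"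
    and no_top: "Upper Q (carrier Q) = {}"
    and meet: "\<And>U V a b. scott_open (adjoin_bounds Q) U \<Longrightarrow> scott_open (adjoin_bounds Q) V \<Longrightarrow>
      a \<in> carrier Q \<Longrightarrow> Elem a \<in> U \<Longrightarrow> b \<in> carrier Q \<Longrightarrow> Elem b \<in> V \<Longrightarrow> \<exists>c. Elem c \<in> U \<inter> V"
  shows "\<not> sober_space (scott_topology (adjoin_bounds Q))"
proof
  let ?L = "adjoin_bounds Q"
  let ?X = "scott_topology ?L"
  let ?C = "carrier ?L - {Top}"
  assume sober: "sober_space ?X"
  interpret L: partial_order ?L
    using assms(1) by (rule partial_order_adjoin_bounds)
  have tops: "topspace ?X = carrier ?L"
    by (rule L.topspace_scott_topology)
  \<comment> \<open>The complement of \<open>A\<close> is an upper set, so if it contains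
    \<open>Bottom\<close> it contains all of \<open>Q\<close>. This reduces irreducibility to open
    sets that meet \<open>Q\<close>.\<close>
  have meets_Elem: "\<exists>a\<in>carrier Q. Elem a \<in> carrier ?L - A"
    if A: "closedin ?X A" "A \<subseteq> ?C" "A \<noteq> ?C" for A
  proof -
    have open_A: "scott_open ?L (carrier ?L - A)"
      using A by (simp add: closedin_def tops openin_scott_topology)
    obtain x where x: "x \<in> ?C" "x \<notin> A"
      using A by blast
    show ?thesis
    proof (cases "x = Bottom")
      case True
      obtain a where a: "a \<in> carrier Q"
        using nonempty by blast
      have "Bottom \<in> carrier ?L - A" "Bottom \<sqsubseteq>\<^bsub>?L\<^esub> Elem a" "Elem a \<in> carrier ?L"
        using True x a by auto
      then have "Elem a \<in> carrier ?L - A"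
        using open_A unfolding scott_open_def by blast
      with a show ?thesis by blast
    next
      case False
      with x show ?thesis by auto
    qed
  qed
  have "irreducible_closedin ?X ?C"
    unfolding irreducible_closedin_def
  proof (intro conjI allI impI)
    have "carrier ?L - ?C = {Top}"
      by auto
    then show "closedin ?X ?C"
      using scott_open_Top[OF ub] by (simp add: closedin_def tops openin_scott_topology)
    show "?C \<noteq> {}"
      by auto
    fix A B assume AB: "closedin ?X A \<and> closedin ?X B \<and> ?C = A \<union> B"
    show "?C = A \<or> ?C = B"
    proof (rule ccontr)
      assume neq: "\<not> (?C = A \<or> ?C = B)"
      obtain a where a: "a \<in> carrier Q" "Elem a \<in> carrier ?L - A"
        using meets_Elem[of A] AB neq by blast
      obtain b where b: "b \<in> carrier Q" "Elem b \<in> carrier ?L - B"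
        using meets_Elem[of B] AB neq by blast
      have "scott_open ?L (carrier ?L - A)" "scott_open ?L (carrier ?L - B)"
        using AB by (auto simp: closedin_def tops openin_scott_topology)
      from meet[OF this a b] obtain c where "Elem c \<in> (carrier ?L - A) \<inter> (carrier ?L - B)" ..
      with AB show False by blast
    qed
  qed
  then obtain x where x: "x \<in> carrier ?L" "?C = ?X closure_of {x}"
    using sober unfolding sober_space_def tops by blast
  have "x \<in> ?C"
    using x tops by (simp add: closure_of_eq in_closure_of)
  \<comment> \<open>A generic point \<open>x\<close> would be the greatest element of
    \<open>?C\<close>, and each of the three possible forms of \<open>x\<close> is then ruled
    out.\<close>
  have below: "y \<sqsubseteq>\<^bsub>?L\<^esub> x" if "y \<in> ?C" for y
    using L.closure_of_subset_down_set[OF x(1)] x(2) that by blast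
  show False
  proof (cases x)
    case Bottom
    obtain a where "a \<in> carrier Q"
      using nonempty by blast
    then show False
      using below[of "Elem a"] Bottom by auto
  next
    case (Elem u)
    have "a \<sqsubseteq>\<^bsub>Q\<^esub> u" if "a \<in> carrier Q" for a
      using below[of "Elem a"] that Elem by simp
    with Elem have "u \<in> Upper Q (carrier Q)"
      using x(1) by (auto simp: Upper_def)
    then show False
      using no_top by blast
  next
    case Top
    then show False
      using \<open>x \<in> ?C\<close> by blast
  qed
qed

section \<open>Compactness of generated topologies\<close>

text \<open>\<open>Alexander_subbase\<close> is stated for the form on the left, \<open>tau\<close>
  is defined by the form on the right.\<close>

lemma topology_generated_by_eq_subbase:
  "topology (arbitrary union_of (finite intersection_of (\<lambda>x. x \<in> \<B>) relative_to \<Union>\<B>))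
    = topology_generated_by \<B>" (is "?X = _")
proof (rule topology_eq[THEN iffD2], intro allI iffI)
  fix S assume S: "openin ?X S"
  show "openin (topology_generated_by \<B>) S"
    by (rule minimal_topology_subbase[OF _ _ S])
      (use openin_topspace[of "topology_generated_by \<B>"] in
        \<open>auto intro: topology_generated_by_Basis simp del: openin_topspace\<close>)
next
  fix S assume "openin (topology_generated_by \<B>) S"
  then have "generate_topology_on \<B> S"
    by (simp add: openin_topology_generated_by_iff)
  moreover have "openin ?X B" if "B \<in> \<B>" for B
  proof -
    have "(finite intersection_of (\<lambda>x. x \<in> \<B>) relative_to \<Union>\<B>) B"
      using that unfolding relative_to_def
      by (intro exI[of _ B] conjI) (auto intro: finite_intersection_of_inc)
    then show ?thesis
      unfolding openin_subbase by (rule arbitrary_union_of_inc)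
  qed
  ultimately show "openin ?X S"
    using generate_topology_on_coarsest[of "openin ?X" \<B> S] by simp
qed

text \<open>Alexander's lemma in dual form: the finite intersection property has to be checked only
  for families of subbasic closed sets. The assumption \<open>cover\<close> makes the whole type the
  underlying space.\<close>

lemma compact_space_topology_generated_by_complements:
  assumes cover: "\<Inter>\<K> = {}"
    and fip: "\<And>\<G>. \<G> \<subseteq> \<K> \<Longrightarrow> (\<And>\<F>. finite \<F> \<Longrightarrow> \<F> \<subseteq> \<G> \<Longrightarrow> \<Inter>\<F> \<noteq> {}) \<Longrightarrow> \<Inter>\<G> \<noteq> {}"
  shows "compact_space (topology_generated_by {UNIV - K | K. K \<in> \<K>})"
proof (rule Alexander_subbase[OF topology_generated_by_eq_subbase])
  let ?B = "{UNIV - K | K. K \<in> \<K>}"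
  fix \<C> assume \<C>: "\<C> \<subseteq> ?B" "\<Union>\<C> = topspace (topology_generated_by ?B)"
  have UNIV: "topspace (topology_generated_by ?B) = UNIV"
    using cover unfolding topology_generated_by_topspace by blast
  define \<G> where "\<G> = uminus ` \<C>"
  have "\<G> \<subseteq> \<K>"
    using \<C>(1) by (auto simp: \<G>_def Compl_eq_Diff_UNIV[symmetric])
  moreover have "\<Inter>\<G> = {}"
    using \<C>(2) unfolding UNIV \<G>_def by blast
  ultimately have "\<exists>\<F>. finite \<F> \<and> \<F> \<subseteq> \<G> \<and> \<Inter>\<F> = {}"
    using fip[of \<G>] by meson
  then obtain \<F> where \<F>: "finite \<F>" "\<F> \<subseteq> \<G>" "\<Inter>\<F> = {}"
    by blast
  have "uminus ` \<F> \<subseteq> uminus ` uminus ` \<C>"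
    using \<F>(2) unfolding \<G>_def by (rule image_mono)
  then have "uminus ` \<F> \<subseteq> \<C>"
    by (simp add: image_image)
  moreover have "\<Union>(uminus ` \<F>) = topspace (topology_generated_by ?B)"
    using \<F>(3) unfolding UNIV by blast
  ultimately show "\<exists>\<C>'. finite \<C>' \<and> \<C>' \<subseteq> \<C> \<and> \<Union>\<C>' = topspace (topology_generated_by ?B)"
    using \<F>(1) finite_imageI by metis
qed

text \<open>If \<open>\<Inter>\<G>\<close> were empty, each of the finitely many points of
  \<open>\<Inter>\<H>\<close> would be missed by some member \<open>g x\<close>. Adding these
  members to \<open>\<H>\<close> gives a finite subfamily with empty intersection.\<close>

lemma Inter_nonempty_if_finite_member:
  assumes fip: "\<And>\<F>. finite \<F> \<Longrightarrow> \<F> \<subseteq> \<G> \<Longrightarrow> \<Inter>\<F> \<noteq> {}"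
    and \<H>: "finite \<H>" "\<H> \<subseteq> \<G>" "finite (\<Inter>\<H>)"
  shows "\<Inter>\<G> \<noteq> {}"
proof
  assume "\<Inter>\<G> = {}"
  then have "\<forall>x. \<exists>G\<in>\<G>. x \<notin> G"
    by blast
  then obtain g where g: "\<And>x. g x \<in> \<G> \<and> x \<notin> g x"
    by metis
  have "\<Inter>(\<H> \<union> g ` \<Inter>\<H>) \<noteq> {}"
    using \<H> g by (intro fip) auto
  then show False
    using g by blast
qed

section \<open>The poset\<close>

lemma P_poset_simps [simp]:
  "carrier (P_poset \<A> e \<beta>) =
    {(C, \<Lambda>). closedin (tau \<A> e \<beta>) C \<and> C \<noteq> {} \<and> \<Lambda> \<subseteq> countable_subsets (UNIV - C)}"
  "eq (P_poset \<A> e \<beta>) = (=)"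
  "(C, \<Lambda>) \<sqsubseteq>\<^bsub>P_poset \<A> e \<beta>\<^esub> (D, \<Gamma>) \<longleftrightarrow> D \<subseteq> C \<and> \<Lambda> \<subseteq> \<Gamma>"
  by (simp_all add: P_poset_def)

lemma partial_order_P_poset: "partial_order (P_poset \<A> e \<beta>)"
  by standard (auto simp: P_poset_def)

text \<open>Suprema are formed componentwise; the only possible obstruction is that the intersection
  of the closed sets is empty.\<close>

lemma is_lub_P_poset:
  assumes D: "D \<subseteq> carrier (P_poset \<A> e \<beta>)" "D \<noteq> {}" and ne: "\<Inter>(fst ` D) \<noteq> {}"
  shows "is_lub (P_poset \<A> e \<beta>) (\<Inter>(fst ` D), \<Union>(snd ` D)) D"
proof -
  have "closedin (tau \<A> e \<beta>) (\<Inter>(fst ` D))"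
    using D by (intro closedin_Inter) auto
  moreover have "\<Union>(snd ` D) \<subseteq> countable_subsets (UNIV - \<Inter>(fst ` D))"
  proof
    fix X assume "X \<in> \<Union>(snd ` D)"
    then obtain C \<Lambda> where C: "(C, \<Lambda>) \<in> D" "X \<in> \<Lambda>"
      by auto
    then have "X \<in> countable_subsets (UNIV - C)" "\<Inter>(fst ` D) \<subseteq> C"
      using D(1) by force+
    then show "X \<in> countable_subsets (UNIV - \<Inter>(fst ` D))"
      by (auto simp: countable_subsets_def)
  qed
  ultimately have "(\<Inter>(fst ` D), \<Union>(snd ` D)) \<in> carrier (P_poset \<A> e \<beta>)"
    using ne by simp
  then show ?thesis
    unfolding least_def Upper_def using D(1) by (fastforce simp: P_poset_def)
qed

lemma complete_lattice_adjoin_bounds_P_poset: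
  "complete_lattice (adjoin_bounds (P_poset \<A> e \<beta>))"
proof (rule complete_lattice_adjoin_bounds[OF partial_order_P_poset])
  fix A assume A: "A \<subseteq> carrier (P_poset \<A> e \<beta>)" "A \<noteq> {}" "Upper (P_poset \<A> e \<beta>) A \<noteq> {}"
  then obtain C \<Lambda> where C: "(C, \<Lambda>) \<in> Upper (P_poset \<A> e \<beta>) A"
    by (metis all_not_in_conv surj_pair)
  then have "C \<noteq> {}"
    by (simp add: Upper_def)
  \<comment> \<open>The nonempty first component of an upper bound lies in every first component, so
    their intersection is nonempty.\<close>
  moreover have "C \<subseteq> fst x" if "x \<in> A" for x
  proof -
    have "x \<sqsubseteq>\<^bsub>P_poset \<A> e \<beta>\<^esub> (C, \<Lambda>)"
      using C A(1) that unfolding Upper_def by blast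
    then show ?thesis
      by (cases x) simp
  qed
  ultimately have "\<Inter>(fst ` A) \<noteq> {}"
    by blast
  then show "\<exists>s. is_lub (P_poset \<A> e \<beta>) s A"
    using is_lub_P_poset[OF A(1,2)] by blast
qed

section \<open>Branches of the binary tree\<close>

lemma restrict_seq_eq_iff:
  "restrict_seq \<xi> m = restrict_seq \<eta> n \<longleftrightarrow> m = n \<and> (\<forall>i<n. \<xi> i = \<eta> i)"
proof -
  have "length (restrict_seq \<xi> m) = m" "length (restrict_seq \<eta> n) = n"
    by (simp_all add: restrict_seq_def)
  moreover have "restrict_seq \<xi> n = restrict_seq \<eta> n \<longleftrightarrow> (\<forall>i<n. \<xi> i = \<eta> i)"
    by (auto simp: restrict_seq_def)
  ultimately show ?thesis by metis
qed

lemma infinite_branch_set: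
  assumes "inj (e A)"
  shows "infinite (branch_set e A \<xi>)"
proof -
  have "inj (\<lambda>n. e A (restrict_seq \<xi> n))"
  proof (rule injI)
    fix m n assume "e A (restrict_seq \<xi> m) = e A (restrict_seq \<xi> n)"
    then have "restrict_seq \<xi> m = restrict_seq \<xi> n"
      using assms by (simp add: inj_eq)
    then show "m = n"
      by (simp add: restrict_seq_eq_iff)
  qed
  then show ?thesis
    using range_inj_infinite by (force simp: branch_set_def full_SetCompr_eq)
qed

text \<open>Two branches that differ at \<open>k\<close> share only restrictions of length at most
  \<open>k\<close>.\<close>

lemma finite_branch_set_Int:
  assumes "inj (e A)" "\<xi> \<noteq> \<eta>"
  shows "finite (branch_set e A \<xi> \<inter> branch_set e A \<eta>)"
proof -
  obtain k where "\<xi> k \<noteq> \<eta> k"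
    using assms(2) by blast
  have "x \<in> (\<lambda>n. e A (restrict_seq \<xi> n)) ` {..k}"
    if x: "x \<in> branch_set e A \<xi>" "x \<in> branch_set e A \<eta>" for x
  proof -
    obtain m n where m: "x = e A (restrict_seq \<xi> m)" and "x = e A (restrict_seq \<eta> n)"
      using x unfolding branch_set_def by blast
    then have "restrict_seq \<xi> m = restrict_seq \<eta> n"
      using assms(1) by (simp add: inj_eq)
    then have "m \<le> k"
      using \<open>\<xi> k \<noteq> \<eta> k\<close> unfolding restrict_seq_eq_iff by (meson not_le)
    with m show ?thesis by simp
  qed
  then have "branch_set e A \<xi> \<inter> branch_set e A \<eta> \<subseteq> (\<lambda>n. e A (restrict_seq \<xi> n)) ` {..k}"
    by blast
  then show ?thesis
    by (rule finite_subset) simp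
qed

section \<open>Almost disjointness and compactness of \<open>tau\<close>\<close>

locale detector =
  fixes \<A> :: "real set set"
    and e :: "real set \<Rightarrow> bool list \<Rightarrow> real"
    and \<beta> :: "real \<Rightarrow> (nat \<Rightarrow> bool)"
  assumes detector_family: "detector_family \<A>"
    and inj_e: "A \<in> \<A> \<Longrightarrow> inj (e A)"
    and range_e: "A \<in> \<A> \<Longrightarrow> range (e A) \<subseteq> A"
    and inj_\<beta>: "inj \<beta>"
begin

abbreviation "P \<equiv> P_poset \<A> e \<beta>"
abbreviation "T \<equiv> tau \<A> e \<beta>"

lemma closedin_K_family: "K \<in> K_family \<A> e \<beta> \<Longrightarrow> closedin T K"
  unfolding closedin_def topspace_tau by (auto simp: tau_def intro: topology_generated_by_Basis)

lemma closedin_singleton: "closedin T {x}"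
  by (rule closedin_K_family) (auto simp: K_family_def)

lemma branch_set_subset: "A \<in> \<A> \<Longrightarrow> branch_set e A \<xi> \<subseteq> A"
  using range_e by (fastforce simp: branch_set_def)

text \<open>Sets from different members of \<open>\<A>\<close> are separated by almost disjointness
  of \<open>\<A>\<close>; sets from the same member follow the distinct branches
  \<open>\<beta> p\<close> and \<open>\<beta> q\<close>.\<close>

lemma finite_S_at_Int:
  assumes "S \<in> S_at \<A> e \<beta> p" "S' \<in> S_at \<A> e \<beta> q" "p \<noteq> q"
  shows "finite (S \<inter> S')"
proof -
  obtain A B where AB: "A \<in> \<A>" "B \<in> \<A>" and S: "S \<subseteq> branch_set e A (\<beta> p)" "S' \<subseteq> branch_set e B (\<beta> q)"
    using assms by (auto simp: S_at_def)
  have "finite (branch_set e A (\<beta> p) \<inter> branch_set e B (\<beta> q))"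
  proof (cases "A = B")
    case True
    then show ?thesis
      using AB assms(3) inj_\<beta> inj_e by (auto intro!: finite_branch_set_Int simp: inj_eq)
  next
    case False
    then have "finite (A \<inter> B)"
      using AB detector_family by (auto simp: detector_family_def)
    then show ?thesis
      by (rule finite_subset[rotated]) (use AB branch_set_subset in blast)
  qed
  then show ?thesis
    by (rule finite_subset[rotated]) (use S in blast)
qed

lemma compact_space_tau: "compact_space T"
  unfolding tau_def
proof (rule compact_space_topology_generated_by_complements)
  have "{0} \<in> K_family \<A> e \<beta>" "{1} \<in> K_family \<A> e \<beta>"
    by (auto simp: K_family_def)
  then have "\<Inter>(K_family \<A> e \<beta>) \<subseteq> {0} \<inter> {1}"
    by blast
  then show "\<Inter>(K_family \<A> e \<beta>) = {}"
    by simp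
next
  fix \<G> assume \<G>: "\<G> \<subseteq> K_family \<A> e \<beta>"
    and fip: "\<And>\<F>. finite \<F> \<Longrightarrow> \<F> \<subseteq> \<G> \<Longrightarrow> \<Inter>\<F> \<noteq> {}"
  show "\<Inter>\<G> \<noteq> {}"
  proof (cases "\<exists>\<H>. finite \<H> \<and> \<H> \<subseteq> \<G> \<and> finite (\<Inter>\<H>)")
    case True
    then show ?thesis
      using Inter_nonempty_if_finite_member[OF fip] by blast
  next
    case False
    then have infinite_Inter: "infinite (\<Inter>\<H>)" if "finite \<H>" "\<H> \<subseteq> \<G>" for \<H>
      using that by blast
    \<comment> \<open>Now every finite subfamily has infinite intersection, so no singleton occurs
      in \<open>\<G>\<close>.\<close>
    have shape: "G = UNIV \<or> (\<exists>p S F. G = K_set p S F \<and> S \<in> S_at \<A> e \<beta> p)" if "G \<in> \<G>" for G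
    proof -
      have "infinite G"
        using infinite_Inter[of "{G}"] that by simp
      then have "G \<notin> {{x} | x. True}"
        by auto
      then show ?thesis
        using that \<G> unfolding K_family_def by blast
    qed
    \<comment> \<open>With different apices the two sets would meet inside
      \<open>{p, q} \<union> (S \<inter> S')\<close>, which is finite. So all members other than
      \<open>UNIV\<close> share one apex, and it lies in \<open>\<Inter>\<G>\<close>.\<close>
    have same: "p = q" if "K_set p S F \<in> \<G>" "S \<in> S_at \<A> e \<beta> p" "K_set q S' F' \<in> \<G>" "S' \<in> S_at \<A> e \<beta> q"
      for p S F q S' F'
    proof (rule ccontr)
      assume "p \<noteq> q"
      then have "finite (insert p (insert q (S \<inter> S')))"
        using finite_S_at_Int that by simp
      then have "finite (\<Inter>{K_set p S F, K_set q S' F'})"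
        by (rule finite_subset[rotated]) (auto simp: K_set_def)
      then show False
        using infinite_Inter[of "{K_set p S F, K_set q S' F'}"] that(1,3) by blast
    qed
    show ?thesis
    proof (cases "\<exists>p S F. K_set p S F \<in> \<G> \<and> S \<in> S_at \<A> e \<beta> p")
      case True
      then obtain p S F where p: "K_set p S F \<in> \<G>" "S \<in> S_at \<A> e \<beta> p"
        by blast
      have "p \<in> G" if "G \<in> \<G>" for G
        using shape[OF that] same[OF p] that by (auto simp: K_set_def)
      then show ?thesis by blast
    next
      case False
      \<comment> \<open>Here no member other than \<open>UNIV\<close> is left; \<open>0\<close> is
        an arbitrary point.\<close>
      with shape have "0 \<in> \<Inter>\<G>" by blast
      then show ?thesis by blast
    qed
  qed
qed

text \<open>Directedness gives the first components the finite intersection property, and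
  compactness then makes the componentwise supremum available.\<close>

lemma Upper_directed_P:
  assumes "directed_in P D"
  shows "Upper P D \<noteq> {}"
proof -
  have D: "D \<subseteq> carrier P" "D \<noteq> {}"
    and dir: "\<And>x y. x \<in> D \<Longrightarrow> y \<in> D \<Longrightarrow> \<exists>z\<in>D. x \<sqsubseteq>\<^bsub>P\<^esub> z \<and> y \<sqsubseteq>\<^bsub>P\<^esub> z"
    using assms unfolding directed_in_def by blast+
  have lower: "\<exists>z\<in>D. fst z \<subseteq> \<Inter>\<F>" if "finite \<F>" "\<F> \<subseteq> fst ` D" for \<F>
    using that
  proof (induction \<F>)
    case empty
    then show ?case
      using D(2) by auto
  next
    case (insert C \<F>)
    then obtain x y where "x \<in> D" "fst x = C" "y \<in> D" "fst y \<subseteq> \<Inter>\<F>"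
      by auto
    moreover from this obtain z where "z \<in> D" "x \<sqsubseteq>\<^bsub>P\<^esub> z" "y \<sqsubseteq>\<^bsub>P\<^esub> z"
      using dir by blast
    ultimately show ?case
      by (intro bexI[of _ z]) (auto simp: P_poset_def case_prod_beta)
  qed
  have "fst z \<noteq> {}" if "z \<in> D" for z
    using D(1) that by auto
  then have "\<Inter>\<F> \<noteq> {}" if "finite \<F>" "\<F> \<subseteq> fst ` D" for \<F>
    using lower[OF that] by blast
  moreover have "\<forall>C\<in>fst ` D. closedin T C"
    using D(1) by auto
  ultimately have "\<Inter>(fst ` D) \<noteq> {}"
    by (intro compact_space_fip[THEN iffD1, rule_format, OF compact_space_tau]) auto
  from is_lub_P_poset[OF D this] show ?thesis
    by (auto simp: least_def)
qed

lemma carrier_P_nonempty: "carrier P \<noteq> {}"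
  using closedin_singleton[of 0] by auto

lemma Upper_carrier_P: "Upper P (carrier P) = {}"
proof (rule ccontr)
  assume "Upper P (carrier P) \<noteq> {}"
  then obtain C \<Lambda> where C: "(C, \<Lambda>) \<in> Upper P (carrier P)"
    by (metis all_not_in_conv surj_pair)
  \<comment> \<open>Singletons are closed, so the first component of a greatest element would lie in
    all of them.\<close>
  have "C \<subseteq> {x}" for x
  proof -
    have "({x}, {}) \<in> carrier P"
      using closedin_singleton by simp
    then have "({x}, {}) \<sqsubseteq>\<^bsub>P\<^esub> (C, \<Lambda>)"
      using C unfolding Upper_def by blast
    then show ?thesis by simp
  qed
  from this[of 0] this[of 1] have "C = {}"
    by auto
  with C show False
    by (simp add: Upper_def)
qed

section \<open>Scott open sets and maximal elements of \<open>P\<close>\<close>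

abbreviation max_elem :: "real \<Rightarrow> real set \<times> real set set" where
  "max_elem p \<equiv> ({p}, countable_subsets (UNIV - {p}))"

text \<open>\<open>max_elem p\<close> is the directed supremum of the points
  \<open>({p}, \<Lambda>)\<close> with \<open>\<Lambda>\<close> finite, since every countable
  \<open>X\<close> avoiding \<open>p\<close> belongs to the finite family
  \<open>{X}\<close>.\<close>

lemma scott_open_finite_support:
  assumes U: "scott_open (adjoin_bounds P) U" and p: "Elem (max_elem p) \<in> U"
  obtains \<Lambda> where "finite \<Lambda>" "\<Lambda> \<subseteq> countable_subsets (UNIV - {p})" "Elem ({p}, \<Lambda>) \<in> U"
proof -
  define D where "D = Pair {p} ` {\<Lambda>. finite \<Lambda> \<and> \<Lambda> \<subseteq> countable_subsets (UNIV - {p})}"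
  have D: "D \<subseteq> carrier P" "D \<noteq> {}"
    using closedin_singleton by (auto simp: D_def)
  have "\<exists>z\<in>D. x \<sqsubseteq>\<^bsub>P\<^esub> z \<and> y \<sqsubseteq>\<^bsub>P\<^esub> z" if xy: "x \<in> D" "y \<in> D" for x y
  proof -
    obtain \<Lambda> \<Gamma> where "x = ({p}, \<Lambda>)" "y = ({p}, \<Gamma>)" "({p}, \<Lambda> \<union> \<Gamma>) \<in> D"
      using xy by (auto simp: D_def)
    then show ?thesis
      by (intro bexI[of _ "({p}, \<Lambda> \<union> \<Gamma>)"]) auto
  qed
  with D have dir: "directed_in P D"
    by (simp add: directed_in_def)
  have fst: "\<Inter>(fst ` D) = {p}"
    using D(2) by (auto simp: D_def)
  have "\<Union>(snd ` D) = \<Union>{\<Lambda>. finite \<Lambda> \<and> \<Lambda> \<subseteq> countable_subsets (UNIV - {p})}"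
    by (simp add: D_def image_image)
  also have "\<dots> = countable_subsets (UNIV - {p})"
    by (auto intro: exI[of _ "{_}"])
  finally have "is_lub P (max_elem p) D"
    using is_lub_P_poset[OF D] fst by simp
  from scott_open_adjoin_bounds_directed[OF U dir this p] show thesis
    using that by (auto simp: D_def)
qed

text \<open>
  For finite \<open>\<Lambda>\<close> the point \<open>({p}, \<Lambda>)\<close> is the directed supremum of the points
  \<open>(K_set p S F, \<Lambda>)\<close> with \<open>F\<close> large enough for \<open>K_set p S F\<close> to avoid \<open>\<Union>\<Lambda>\<close>.
\<close>

lemma scott_open_almost_contains:
  assumes U: "scott_open (adjoin_bounds P) U"
    and \<Lambda>: "\<Lambda> \<subseteq> countable_subsets (UNIV - {p})" "Elem ({p}, \<Lambda>) \<in> U"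
    and S: "S \<in> S_at \<A> e \<beta> p" "finite (S \<inter> \<Union>\<Lambda>)"
  shows "\<exists>F. finite F \<and> (\<forall>q\<in>S - F. Elem (max_elem q) \<in> U)"
proof -
  \<comment> \<open>Removing at least \<open>S \<inter> \<Union>\<Lambda>\<close> makes
    \<open>K_set p S F\<close> disjoint from \<open>\<Union>\<Lambda>\<close>, so that
    \<open>(K_set p S F, \<Lambda>)\<close> belongs to \<open>P\<close>.\<close>
  define \<F> where "\<F> = {F. finite F \<and> S \<inter> \<Union>\<Lambda> \<subseteq> F \<and> F \<subseteq> S}"
  define D where "D = (\<lambda>F. (K_set p S F, \<Lambda>)) ` \<F>"
  have p: "p \<notin> S" "p \<notin> \<Union>\<Lambda>"
    using S(1) \<Lambda>(1) by (auto simp: S_at_def countable_subsets_def)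
  have mem: "S \<inter> \<Union>\<Lambda> \<in> \<F>"
    using S by (auto simp: \<F>_def)
  have \<Lambda>_sub: "\<Lambda> \<subseteq> countable_subsets (UNIV - K_set p S F)" if "F \<in> \<F>" for F
    using that p \<Lambda>(1) by (auto simp: \<F>_def K_set_def countable_subsets_def)
  have "closedin T (K_set p S F)" if "F \<in> \<F>" for F
    using that S by (intro closedin_K_family) (auto simp: \<F>_def K_family_def)
  then have D: "D \<subseteq> carrier P" "D \<noteq> {}"
    using \<Lambda>_sub mem by (auto simp: D_def K_set_def)
  have "\<exists>z\<in>D. x \<sqsubseteq>\<^bsub>P\<^esub> z \<and> y \<sqsubseteq>\<^bsub>P\<^esub> z" if xy: "x \<in> D" "y \<in> D" for x y
  proof -
    obtain F G where FG: "F \<in> \<F>" "G \<in> \<F>" and eq: "x = (K_set p S F, \<Lambda>)" "y = (K_set p S G, \<Lambda>)"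
      using xy unfolding D_def by blast
    have "F \<union> G \<in> \<F>"
      using FG by (auto simp: \<F>_def)
    then have "(K_set p S (F \<union> G), \<Lambda>) \<in> D"
      by (auto simp: D_def)
    then show ?thesis
      by (rule bexI[rotated]) (auto simp: eq K_set_def)
  qed
  with D have dir: "directed_in P D"
    by (simp add: directed_in_def)
  have "x = p" if x: "x \<in> \<Inter>(fst ` D)" for x
  proof (rule ccontr)
    assume "x \<noteq> p"
    have in_K: "x \<in> K_set p S F" if "F \<in> \<F>" for F
      using x that by (simp add: D_def)
    have "x \<in> S"
      using in_K[OF mem] \<open>x \<noteq> p\<close> by (simp add: K_set_def)
    \<comment> \<open>Any point of \<open>S\<close> can itself be added to the removed set, so only
      the apex survives in the intersection.\<close>
    then have "insert x (S \<inter> \<Union>\<Lambda>) \<in> \<F>"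
      using S by (auto simp: \<F>_def)
    from in_K[OF this] show False
      using \<open>x \<noteq> p\<close> by (simp add: K_set_def)
  qed
  then have fst: "\<Inter>(fst ` D) = {p}"
    by (auto simp: D_def K_set_def)
  have snd: "\<Union>(snd ` D) = \<Lambda>"
    using mem by (auto simp: D_def)
  have "is_lub P ({p}, \<Lambda>) D"
    using is_lub_P_poset[OF D] fst snd by simp
  from scott_open_adjoin_bounds_directed[OF U dir this \<Lambda>(2)]
  obtain F where F: "F \<in> \<F>" "Elem (K_set p S F, \<Lambda>) \<in> U"
    by (auto simp: D_def)
  \<comment> \<open>Each remaining \<open>q\<close> lies in \<open>K_set p S F\<close>, which puts
    \<open>max_elem q\<close> above a point already in \<open>U\<close>.\<close>
  have "Elem (max_elem q) \<in> U" if q: "q \<in> S - F" for q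
  proof (rule scott_open_adjoin_bounds_mono[OF U F(2)])
    show "max_elem q \<in> carrier P"
      using closedin_singleton by simp
    have "q \<in> K_set p S F"
      using q by (simp add: K_set_def)
    then show "(K_set p S F, \<Lambda>) \<sqsubseteq>\<^bsub>P\<^esub> max_elem q"
      using \<Lambda>_sub[OF F(1)] by (auto simp: countable_subsets_def)
  qed
  then show ?thesis
    using F(1) by (auto simp: \<F>_def)
qed

lemma scott_open_cocountable:
  assumes U: "scott_open (adjoin_bounds P) U" and a: "a \<in> carrier P" "Elem a \<in> U"
  shows "countable {p. Elem (max_elem p) \<notin> U}"
proof (rule ccontr)
  let ?W = "{p. Elem (max_elem p) \<notin> U}"
  assume W: "uncountable ?W"
  obtain C \<Gamma> p where C: "a = (C, \<Gamma>)" "p \<in> C"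
    using a(1) by auto
  \<comment> \<open>A point \<open>(C, \<Gamma>)\<close> of \<open>P\<close> lies below
    \<open>max_elem p\<close> for every \<open>p\<close> in \<open>C\<close>.\<close>
  have "Elem (max_elem p) \<in> U"
    by (rule scott_open_adjoin_bounds_mono[OF U a(2)])
      (use a(1) C closedin_singleton in \<open>auto simp: countable_subsets_def\<close>)
  then obtain \<Lambda> where \<Lambda>: "finite \<Lambda>" "\<Lambda> \<subseteq> countable_subsets (UNIV - {p})" "Elem ({p}, \<Lambda>) \<in> U"
    by (rule scott_open_finite_support[OF U])
  have "countable (\<Union>\<Lambda>)"
    using \<Lambda>(1,2) countable_UN[of \<Lambda> "\<lambda>X. X"]
    by (auto simp: countable_subsets_def countable_finite)
  then have "uncountable (?W - \<Union>\<Lambda>)"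
    using W uncountable_minus_countable by blast
  \<comment> \<open>The detector set is chosen off \<open>\<Union>\<Lambda>\<close>, so its branch
    at \<open>p\<close> meets the finite support trivially while staying inside
    \<open>?W\<close>.\<close>
  then obtain A where A: "A \<in> \<A>" "A \<subseteq> ?W - \<Union>\<Lambda>"
    using detector_family unfolding detector_family_def by blast
  define S where "S = branch_set e A (\<beta> p) - {p}"
  have S: "S \<in> S_at \<A> e \<beta> p" "infinite S"
    using A(1) infinite_branch_set[of e A] inj_e by (auto simp: S_def S_at_def)
  have S_sub: "S \<subseteq> ?W - \<Union>\<Lambda>"
    using A branch_set_subset[OF A(1), of "\<beta> p"] unfolding S_def by blast
  from S_sub have "S \<inter> \<Union>\<Lambda> = {}"
    by blast
  then obtain F where F: "finite F" "\<forall>q\<in>S - F. Elem (max_elem q) \<in> U"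
    using scott_open_almost_contains[OF U \<Lambda>(2,3) S(1)] by auto
  \<comment> \<open>Any point of \<open>S - F\<close> is contradictory: its maximal element is in
    \<open>U\<close>, yet the point lies in \<open>?W\<close>.\<close>
  have "S - F \<noteq> {}"
  proof
    assume "S - F = {}"
    then have "S \<subseteq> F"
      by simp
    then show False
      using F(1) S(2) finite_subset by metis
  qed
  then show False
    using F(2) S_sub by blast
qed

lemma scott_open_meet:
  assumes "scott_open (adjoin_bounds P) U" "scott_open (adjoin_bounds P) V"
    and "a \<in> carrier P" "Elem a \<in> U" "b \<in> carrier P" "Elem b \<in> V"
  shows "\<exists>c. Elem c \<in> U \<inter> V"
proof -
  \<comment> \<open>A real outside both exceptional sets yields a maximal element common to
    \<open>U\<close> and \<open>V\<close>.\<close>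
  have "countable ({p. Elem (max_elem p) \<notin> U} \<union> {p. Elem (max_elem p) \<notin> V})"
    using assms scott_open_cocountable by blast
  then have "{p. Elem (max_elem p) \<notin> U} \<union> {p. Elem (max_elem p) \<notin> V} \<noteq> UNIV"
    using uncountable_UNIV_real by metis
  then show ?thesis by blast
qed

end

theorem theorem6p5:
  fixes \<A> :: "real set set"
    and e :: "real set \<Rightarrow> bool list \<Rightarrow> real"
    and \<beta> :: "real \<Rightarrow> (nat \<Rightarrow> bool)"
  assumes "detector_family \<A>"
    and "\<And>A. A \<in> \<A> \<Longrightarrow> inj (e A) \<and> range (e A) \<subseteq> A"
    and "bij \<beta>"
  shows "complete_lattice (adjoin_bounds (P_poset \<A> e \<beta>)) \<and>
         \<not> sober_space (scott_topology (adjoin_bounds (P_poset \<A> e \<beta>)))"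
proof
  interpret detector \<A> e \<beta>
    using assms by unfold_locales (auto simp: bij_def)
  show "\<not> sober_space (scott_topology (adjoin_bounds P))"
    by (rule not_sober_adjoin_bounds[OF partial_order_P_poset Upper_directed_P carrier_P_nonempty
          Upper_carrier_P scott_open_meet])
qed (rule complete_lattice_adjoin_bounds_P_poset)

end
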